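(* In $\mathbb{Q}[[x]]$ we have the continued fraction expansion $$\sum_{n\geq 0} E_n x^n = b_0+\cfrac{a_1}{b_1+\cfrac{a_2}{b_2+\cfrac{a_3}{b_3+\cdots}}},$$ where $a_1=1$; $a_{3k}=-(4k-1)^2(2k-1)x^3$ for $k\ge1$; $a_{3k+1}=-4k^2x^2$ for $k\ge 1$; $a_{3k+2}=-(4k+1)^2(2k+1)x^3$ for $k\ge 0$; and $b_0=0$; $b_{3k}=1-(6k-1)x$ for $k\ge1$; $b_{3k+1}=1-(6k+1)x$ for $k\ge0$; $b_{3k+2}=1-2(2k+1)x-4(2k+1)^2x^2$ for $k\ge0$. Explicitly, the expansion begins $$\frac{1}{1-x-\cfrac{x^3}{1-2x-4x^2-\cfrac{9x^3}{1-5x-\cfrac{4x^2}{1-7x-\cfrac{75x^3}{1-6x-36x^2-\cdots}}}}}.$$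
   Context: The Euler numbers $E_n$ ($n\ge 0$) are defined by $\tan(x)+\sec(x)=\sum_{n\ge0}E_n\frac{x^n}{n!}$ (so $E_0,E_1,E_2,\dots=1,1,1,2,5,16,61,272,\dots$). A continued fraction $b_0+\cfrac{a_1}{b_1+\cfrac{a_2}{b_2+\cdots}}$ with $a_j,b_j$ polynomials in $x$ denotes the formal power series in $x$ which is the $x$-adic limit of its successive convergents. *)

theory Defs
  imports Complex_Main "HOL-Computational_Algebra.Computational_Algebra"
begin

text \<open>
  The Euler (zigzag) numbers, including both secant and tangent numbers:
  \<open>tan x + sec x = (\<Sum>n. euler_number n * x ^ n / n!)\<close>.
\<close>

definition euler_number :: "nat \<Rightarrow> rat" where
  "euler_number n = fact n * fps_nth (fps_tan 1 + 1 / fps_cos 1) n"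

text \<open>
  \<open>cfrac_segment a b m j\<close> is the finite continued fraction
  \<open>b\<^sub>j + a\<^sub>j\<^sub>+\<^sub>1 / (b\<^sub>j\<^sub>+\<^sub>1 + \<dots> + a\<^sub>j\<^sub>+\<^sub>m / b\<^sub>j\<^sub>+\<^sub>m)\<close>; the value \<open>a 0\<close> is never used.
\<close>

primrec cfrac_segment ::
  "(nat \<Rightarrow> 'a::field poly) \<Rightarrow> (nat \<Rightarrow> 'a poly) \<Rightarrow> nat \<Rightarrow> nat \<Rightarrow> 'a fps" where
  "cfrac_segment a b 0 j = fps_of_poly (b j)"
| "cfrac_segment a b (Suc m) j =
     fps_of_poly (b j) + fps_of_poly (a (Suc j)) / cfrac_segment a b m (Suc j)"

definition cfrac_convergent ::
  "(nat \<Rightarrow> 'a::field poly) \<Rightarrow> (nat \<Rightarrow> 'a poly) \<Rightarrow> nat \<Rightarrow> 'a fps" where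
  "cfrac_convergent a b n = cfrac_segment a b n 0"

text \<open>
  The first conjunct says that every denominator is a unit of the power series ring, so that
  no convergent involves the arbitrary value of a division by a non-unit. The limit in the
  second conjunct is taken in the metric topology of \<^typ>\<open>'a fps\<close>, which is the
  \<open>x\<close>-adic one.
\<close>

definition has_cfrac_expansion ::
  "'a::field fps \<Rightarrow> (nat \<Rightarrow> 'a poly) \<Rightarrow> (nat \<Rightarrow> 'a poly) \<Rightarrow> bool" where
  "has_cfrac_expansion f a b \<longleftrightarrow>
     (\<forall>m. \<forall>j\<ge>1. fps_nth (cfrac_segment a b m j) 0 \<noteq> 0) \<and>
     cfrac_convergent a b \<longlonglongrightarrow> f"

end

theory Submission
  imports Defs
begin

text \<open>
  Let \<open>u = tan + sec - 1\<close>, so that \<open>u' = 1 + u + u\<^sup>2 / 2\<close>. The formal Laplace transform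
  \<open>L (\<Sum>n. c\<^sub>n x\<^sup>n) = (\<Sum>n. n! c\<^sub>n x\<^sup>n)\<close> maps \<open>1 + u\<close> to the given series and turns differentiation
  (of series without constant term) into division by \<open>x\<close>. If \<open>P\<^sub>n / Q\<^sub>n\<close> is the
  \<open>n\<close>-th convergent, the remainder \<open>R\<^sub>n = Q\<^sub>n f - P\<^sub>n\<close> satisfies
  \<open>R\<^sub>n = b\<^sub>n R\<^sub>n\<^sub>-\<^sub>1 + a\<^sub>n R\<^sub>n\<^sub>-\<^sub>2\<close> with \<open>R\<^sub>-\<^sub>1 = -1\<close>. It has a closed form: up to explicit rational
  factors, \<open>R\<^sub>3\<^sub>k\<close>, \<open>R\<^sub>3\<^sub>k\<^sub>+\<^sub>1\<close>, \<open>R\<^sub>3\<^sub>k\<^sub>+\<^sub>2\<close> are powers of \<open>x\<close> times the Laplace transforms of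
  \<open>u\<^bsup>4k\<^esup> (1 + u)\<close>, \<open>u\<^bsup>4k+2\<^esup>\<close>, \<open>u\<^bsup>4k+3\<^esup> (1 + u / 2)\<close>. The recurrence then becomes a
  polynomial identity in \<open>u\<close>, and the \<open>x\<close>-adic order of \<open>R\<^sub>n\<close> tends to infinity.
\<close>

section \<open>Convergence of a continued fraction from the decay of its remainders\<close>

lemma cfrac_segment_nth_0:
  assumes "\<And>j. j \<ge> 1 \<Longrightarrow> poly.coeff (b j) 0 \<noteq> 0" "\<And>j. j \<ge> 2 \<Longrightarrow> poly.coeff (a j) 0 = 0" "j \<ge> 1"
  shows "fps_nth (cfrac_segment a b m j) 0 \<noteq> 0"
  using assms(3)
proof (induction m arbitrary: j)
  case (Suc m)
  \<comment> \<open>The quotient has no constant term, as \<open>Suc j \<ge> 2\<close>; only that of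
    \<open>b j\<close> remains.\<close>
  then show ?case
    using assms(1)[of j] assms(2)[of "Suc j"] Suc.IH[of "Suc j"]
    by (simp add: fps_divide_unit)
qed (simp add: assms(1))

text \<open>Reading the recurrence backwards, the expression at \<open>j\<close> is the one at
  \<open>Suc j\<close>, with a tail one level shorter, divided by that tail, which is a unit.
  Iterating ends at \<open>S (j + m + 2)\<close>.\<close>

lemma power_dvd_cfrac_segment:
  assumes unit: "\<And>m j. j \<ge> 1 \<Longrightarrow> fps_nth (cfrac_segment a b m j) 0 \<noteq> 0"
    and rec: "\<And>n. S (Suc (Suc n)) = fps_of_poly (b (Suc n)) * S (Suc n) + fps_of_poly (a (Suc n)) * S n"
    and "p dvd S (j + m + 2)"
  shows "p dvd cfrac_segment a b m (Suc j) * S (Suc j) + fps_of_poly (a (Suc j)) * S j"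
  using assms(3)
proof (induction m arbitrary: j)
  case 0
  then show ?case using rec[of j] by simp
next
  case (Suc m)
  let ?s = "cfrac_segment a b m (Suc (Suc j))"
  have inv: "inverse ?s * ?s = 1"
    by (rule inverse_mult_eq_1) (use unit in simp)
  have "p dvd ?s * S (Suc (Suc j)) + fps_of_poly (a (Suc (Suc j))) * S (Suc j)"
    using Suc by simp
  then have "p dvd inverse ?s * (?s * S (Suc (Suc j)) + fps_of_poly (a (Suc (Suc j))) * S (Suc j))"
    by (rule dvd_mult)
  also have "\<dots> = S (Suc (Suc j)) + fps_of_poly (a (Suc (Suc j))) * inverse ?s * S (Suc j)"
    using inv by algebra
  also have "\<dots> = cfrac_segment a b (Suc m) (Suc j) * S (Suc j) + fps_of_poly (a (Suc j)) * S j"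
    using unit[of "Suc (Suc j)" m] by (simp add: rec[of j] fps_divide_unit algebra_simps)
  finally show ?case .
qed

text \<open>At \<open>j = 0\<close> the preceding expression divided by its tail is the error of a
  convergent, because of the values of \<open>S 0\<close> and \<open>S 1\<close>. So convergent
  number m agrees with \<open>f\<close> below degree m.\<close>

lemma has_cfrac_expansionI:
  assumes b: "\<And>j. j \<ge> 1 \<Longrightarrow> poly.coeff (b j) 0 \<noteq> 0"
    and a: "\<And>j. j \<ge> 2 \<Longrightarrow> poly.coeff (a j) 0 = 0"
    and S0: "S 0 = - 1" and S1: "S 1 = f - fps_of_poly (b 0)"
    and rec: "\<And>n. S (Suc (Suc n)) = fps_of_poly (b (Suc n)) * S (Suc n) + fps_of_poly (a (Suc n)) * S n"
    and dvd: "\<And>n. fps_X ^ n dvd S (Suc n)"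
  shows "has_cfrac_expansion f a b"
proof -
  have unit: "fps_nth (cfrac_segment a b m j) 0 \<noteq> 0" if "j \<ge> 1" for m j
    using a b that by (intro cfrac_segment_nth_0) auto
  have close: "fps_X ^ Suc m dvd f - cfrac_convergent a b (Suc m)" for m
  proof -
    let ?s = "cfrac_segment a b m (Suc 0)"
    have "fps_X ^ Suc m dvd inverse ?s * (?s * S (Suc 0) + fps_of_poly (a (Suc 0)) * S 0)"
      by (intro dvd_mult power_dvd_cfrac_segment unit rec) (use dvd[of "Suc m"] in simp_all)
    moreover have "inverse ?s * ?s = 1"
      by (rule inverse_mult_eq_1) (use unit in simp)
    then have "inverse ?s * (?s * S (Suc 0) + fps_of_poly (a (Suc 0)) * S 0) =
        S 1 - fps_of_poly (a (Suc 0)) * inverse ?s"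
      unfolding S0 One_nat_def by algebra
    moreover have "\<dots> = f - cfrac_convergent a b (Suc m)"
      using unit[of "Suc 0" m] unfolding S1 by (simp add: cfrac_convergent_def fps_divide_unit)
    ultimately show ?thesis by simp
  qed
  have "fps_nth (cfrac_convergent a b m) n = fps_nth f n" if "n < m" for m n
  proof -
    have "fps_X ^ m dvd f - cfrac_convergent a b m"
      using close[of "m - 1"] that by (cases m) simp_all
    then obtain c where "f - cfrac_convergent a b m = fps_X ^ m * c"
      by (elim dvdE)
    then have "fps_nth (f - cfrac_convergent a b m) n = 0"
      using that by (simp only: fps_X_power_mult_nth) simp
    then show ?thesis by simp
  qed
  then have "cfrac_convergent a b \<longlonglongrightarrow> f"
    unfolding tendsto_fps_iff eventually_sequentially by (meson Suc_le_eq)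
  then show ?thesis
    using unit by (simp add: has_cfrac_expansion_def)
qed

section \<open>The formal Laplace transform\<close>

definition fps_laplace :: "'a::field_char_0 fps \<Rightarrow> 'a fps" where
  "fps_laplace f = Abs_fps (\<lambda>n. fact n * fps_nth f n)"

lemma fps_laplace_add: "fps_laplace (f + g) = fps_laplace f + fps_laplace g"
  by (simp add: fps_laplace_def fps_eq_iff algebra_simps)

lemma fps_laplace_diff:
  "fps_laplace (f - g) = fps_laplace f - fps_laplace g"
  by (simp add: fps_laplace_def fps_eq_iff algebra_simps)

lemma fps_laplace_const: "fps_laplace (fps_const c * f) = fps_const c * fps_laplace f"
  by (simp add: fps_laplace_def fps_eq_iff)

lemma fps_laplace_of_nat:
  "fps_laplace (of_nat n * f) = of_nat n * fps_laplace f"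
  by (metis fps_laplace_const fps_of_nat)

text \<open>The factor n + 1 from differentiation turns n! into (n + 1)!; the constant term is lost,
  hence the assumption.\<close>

lemma fps_X_mult_laplace_deriv:
  assumes "fps_nth f 0 = 0"
  shows "fps_X * fps_laplace (fps_deriv f) = fps_laplace f"
proof (rule fps_ext)
  fix n show "fps_nth (fps_X * fps_laplace (fps_deriv f)) n = fps_nth (fps_laplace f) n"
    using assms by (cases n) (simp_all add: fps_laplace_def)
qed

section \<open>The differential equation for u\<close>

text \<open>The constant term is removed: this is the series \<open>u\<close> above.\<close>

definition tansec :: "rat fps" where "tansec = fps_tan 1 + 1 / fps_cos 1 - 1"

lemma tansec_0: "fps_nth tansec 0 = 0"
  by (simp add: tansec_def fps_tan_def fps_divide_unit)

text \<open>With s and c for sine and cosine, both sides equal (1 + s) / c^2, by s^2 + c^2 = 1 and 1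
  + u + u^2/2 = (1 + (1 + u)^2) / 2.\<close>

lemma tansec_deriv: "fps_deriv tansec = 1 + tansec + fps_const (1/2) * tansec ^ 2"
proof -
  let ?s = "fps_sin 1 :: rat fps" and ?c = "fps_cos 1 :: rat fps" and ?h = "fps_const (1/2) :: rat fps"
  let ?i = "inverse ?c"
  have c0: "fps_nth ?c 0 \<noteq> 0" by simp
  have u: "tansec = ?s * ?i + ?i - 1"
    using c0 by (simp add: tansec_def fps_tan_def fps_divide_unit)
  have i: "?i * ?c = 1" by (rule inverse_mult_eq_1) simp
  have pyth: "?c ^ 2 + ?s ^ 2 = 1" by (rule fps_sin_cos_sum_of_squares)
  have d: "fps_deriv ?i = ?s * ?i ^ 2"
    by (subst fps_inverse_deriv) (simp_all add: fps_cos_deriv flip: fps_const_neg)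
  have h: "2 * ?h = 1" by (simp add: fps_numeral_fps_const)
  have "fps_deriv tansec = 1 + ?s * (?s * ?i ^ 2) + ?s * ?i ^ 2"
    unfolding u using i by (simp add: d fps_sin_deriv algebra_simps)
  also have "\<dots> = 1 + (?s * ?i + ?i - 1) + ?h * (?s * ?i + ?i - 1) ^ 2"
    using i pyth h by algebra
  finally show ?thesis unfolding u .
qed

section \<open>Remainders before the Laplace transform\<close>

text \<open>This is (4k)!/16^k. The factors stay separate so that the constants of
  \<open>rem1\<close> and \<open>rem2\<close>, namely (4k+1)!/(2*16^k) and (4k+3)!/(4*16^k), are
  partial products of one step.\<close>

primrec rem_coeff :: "nat \<Rightarrow> rat" where
  "rem_coeff 0 = 1"
| "rem_coeff (Suc k) =
     rem_coeff k * (4 * of_nat k + 1) * (1/2) * (2 * of_nat k + 1) * (4 * of_nat k + 3) * (of_nat k + 1)"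

definition rem0 :: "nat \<Rightarrow> rat fps" where
  "rem0 k = fps_const (rem_coeff k) * (tansec ^ (4 * k) * (1 + tansec))"

definition rem1 :: "nat \<Rightarrow> rat fps" where
  "rem1 k = fps_const (rem_coeff k * (4 * of_nat k + 1) * (1/2)) * (tansec ^ (4 * k) * tansec ^ 2)"

definition rem2 :: "nat \<Rightarrow> rat fps" where
  "rem2 k = fps_const (rem_coeff k * (4 * of_nat k + 1) * (1/2) * (2 * of_nat k + 1) * (4 * of_nat k + 3)) *
     (tansec ^ (4 * k) * tansec ^ 3 * (1 + fps_const (1/2) * tansec))"

lemmas push_fps_const = fps_const_add[symmetric] fps_const_sub[symmetric] fps_const_mult[symmetric]
  fps_const_neg[symmetric] fps_const_power[symmetric] numeral_fps_const[symmetric] fps_const_1_eq_1 fps_of_nat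

lemma two_mult_half_fps: "2 * fps_const (1/2) = (1 :: rat fps)"
  by (simp add: numeral_fps_const)

text \<open>The extra factor u avoids the exponent \<open>n - 1\<close>, so the relation is
  polynomial for every \<open>n\<close>.\<close>

lemma tansec_mult_deriv_power:
  "tansec * fps_deriv (tansec ^ n) = of_nat n * tansec ^ n * (1 + tansec + fps_const (1/2) * tansec ^ 2)"
  by (cases n) (simp_all only: fps_deriv_power' tansec_deriv, simp_all add: algebra_simps)

text \<open>
  Everything is expressed through \<open>w = u\<^bsup>4j\<^esup>\<close>, whose only relevant property is \<open>u w' = 4 j w u'\<close>;
  the recurrences are then consequences of ring identities.
\<close>

lemma rem_recurrences:
  fixes j :: nat
  defines "K \<equiv> of_nat j :: rat fps"
  shows rem1_Suc: "rem1 (Suc j) = fps_deriv (rem0 (Suc j)) - (6 * K + 7) * rem0 (Suc j)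
     - 4 * (K + 1) ^ 2 * rem2 j" (is ?T1)
  and rem2: "rem2 j = fps_deriv (fps_deriv (rem1 j)) - 2 * (2 * K + 1) * fps_deriv (rem1 j)
     - 4 * (2 * K + 1) ^ 2 * rem1 j - (4 * K + 1) ^ 2 * (2 * K + 1) * rem0 j" (is ?T2)
  and rem0_Suc: "rem0 (Suc j) = fps_deriv (rem2 j) - (6 * K + 5) * rem2 j
     - (4 * K + 3) ^ 2 * (2 * K + 1) * rem1 j" (is ?T3)
proof -
  define h where "h = (fps_const (1/2) :: rat fps)"
  define w where "w = tansec ^ (4 * j)"
  let ?u = tansec
  let ?du = "1 + tansec + h * tansec ^ 2"
  let ?dw = "fps_deriv w"
  have w: "?u * ?dw = 4 * K * w * ?du"
    unfolding w_def K_def h_def tansec_mult_deriv_power by simp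
  have h: "2 * h = 1" unfolding h_def by (rule two_mult_half_fps)
  define A where "A = fps_const (rem_coeff j)"
  \<comment> \<open>The constant of \<open>rem2 j\<close>; times \<open>K + 1\<close> it is that of
    \<open>rem0 (Suc j)\<close>.\<close>
  define C where "C = A * (4 * K + 1) * h * (2 * K + 1) * (4 * K + 3)"
  have du: "fps_deriv ?u = ?du"
    unfolding h_def by (rule tansec_deriv)
  have dh: "fps_deriv h = 0" by (simp add: h_def)
  have dK: "fps_deriv K = 0" and dA: "fps_deriv A = 0"
    by (simp_all add: K_def A_def)
  have dC: "fps_deriv C = 0"
    by (simp add: C_def dA dK dh)
  have A': "fps_const (rem_coeff (Suc j)) = C * (K + 1)"
    unfolding C_def A_def K_def h_def rem_coeff.simps push_fps_const by (rule refl)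
  have 0: "rem0 j = A * (w * (1 + ?u))"
    by (simp add: rem0_def A_def w_def)
  have 1: "rem1 j = A * (4 * K + 1) * h * (w * ?u ^ 2)"
    unfolding rem1_def w_def A_def K_def h_def push_fps_const by (rule refl)
  have 2: "rem2 j = C * (w * ?u ^ 3 * (1 + h * ?u))"
    unfolding rem2_def w_def A_def C_def K_def h_def push_fps_const by (rule refl)
  have 3: "rem0 (Suc j) = C * (K + 1) * (w * ?u ^ 4 * (1 + ?u))"
    unfolding rem0_def A' by (simp add: w_def power_add mult_ac)
  have "rem1 (Suc j) = fps_const (rem_coeff (Suc j)) * (4 * K + 5) * h * (?u ^ (4 * Suc j) * ?u ^ 2)"
    unfolding rem1_def K_def h_def of_nat_Suc push_fps_const by (simp add: algebra_simps)
  then have 4: "rem1 (Suc j) = C * (K + 1) * (4 * K + 5) * h * (w * ?u ^ 6)"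
    unfolding A' by (simp add: w_def power_add mult_ac)
  have d0: "fps_deriv (rem0 (Suc j)) = C * (K + 1) *
     (?dw * ?u ^ 4 * (1 + ?u) + w * (4 * ?u ^ 3 * ?du * (1 + ?u) + ?u ^ 4 * ?du))"
    unfolding 3 by (simp add: fps_deriv_power' du dK dC dh algebra_simps)
  show ?T1
    unfolding d0 unfolding 3 4 2 using w h by algebra
  have d2: "fps_deriv (rem2 j) = C *
     (?dw * ?u ^ 3 * (1 + h * ?u) + w * (3 * ?u ^ 2 * ?du * (1 + h * ?u) + ?u ^ 3 * (h * ?du)))"
    unfolding 2 by (simp add: fps_deriv_power' du dK dC dh algebra_simps)
  show ?T3
    unfolding d2 unfolding 3 1 2 using w h C_def by algebra
  \<comment> \<open>Eliminating \<open>?dw\<close> before differentiating again keeps the second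
    derivative of \<open>w\<close> out; the new \<open>?dw\<close> then comes with a factor
    \<open>?u\<close> and is eliminated as well.\<close>
  have d1: "fps_deriv (rem1 j) = A * (4 * K + 1) * h * ((4 * K + 2) * (w * ?u * ?du))"
  proof -
    have "fps_deriv (rem1 j) = A * (4 * K + 1) * h * (?dw * ?u ^ 2 + w * (2 * ?u * ?du))"
      unfolding 1 by (simp add: fps_deriv_power' du dK dA dh algebra_simps)
    then show ?thesis using w by algebra
  qed
  have "fps_deriv (fps_deriv (rem1 j)) = A * (4 * K + 1) * h * ((4 * K + 2) *
     (?dw * ?u * ?du + w * ?du * ?du + w * ?u * (?du + 2 * h * ?u * ?du)))"
    unfolding d1 by (simp add: fps_deriv_power' du dK dA dh algebra_simps)
  then have dd1: "fps_deriv (fps_deriv (rem1 j)) = A * (4 * K + 1) * h * ((4 * K + 2) *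
     (4 * K * w * ?du * ?du + w * ?du * ?du + w * ?u * (?du + 2 * h * ?u * ?du)))"
    using w by algebra
  show ?T2
    unfolding dd1 unfolding d1 unfolding 2 1 0 C_def using h by algebra
qed

lemmas of_nat_push = of_nat_add of_nat_mult of_nat_power of_nat_numeral of_nat_1

text \<open>These license each passage from a derivative to division by x. \<open>rem0 0\<close> has
  constant term 1 and is left out.\<close>

lemma rem_nth_0:
  "fps_nth (rem0 (Suc k)) 0 = 0" "fps_nth (rem1 k) 0 = 0" "fps_nth (rem2 k) 0 = 0"
  "fps_nth (fps_deriv (rem1 k)) 0 = 0"
  by (simp_all add: rem0_def rem1_def rem2_def fps_deriv_power' tansec_0 fps_power_zeroth del: fps_deriv_nth)

section \<open>The three-term recurrence of the remainders\<close>

text \<open>The index is shifted by one: \<open>remainder n\<close> is \<open>R\<^sub>n\<^sub>-\<^sub>1\<close>.\<close>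

definition remainder :: "nat \<Rightarrow> rat fps" where
  "remainder n = (if n = 0 then - 1 else
     let k = (n - 1) div 3 in
     if (n - 1) mod 3 = 0 then fps_X ^ (4 * k) * fps_laplace (rem0 k)
     else if (n - 1) mod 3 = 1 then fps_X ^ (4 * k + 1) * fps_laplace (rem1 k)
     else fps_X ^ (4 * k + 3) * fps_laplace (rem2 k))"

lemma remainder_simps:
  "remainder 0 = - 1"
  "remainder (Suc (3 * k)) = fps_X ^ (4 * k) * fps_laplace (rem0 k)"
  "remainder (Suc (Suc (3 * k))) = fps_X ^ (4 * k + 1) * fps_laplace (rem1 k)"
  "remainder (Suc (Suc (Suc (3 * k)))) = fps_X ^ (4 * k + 3) * fps_laplace (rem2 k)"
  by (simp_all add: remainder_def Let_def div_Suc mod_Suc numeral_3_eq_3[symmetric])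

lemma three_times_Suc: "3 * Suc k = Suc (Suc (Suc (3 * k)))"
  by simp

lemma nat_mod_3_cases:
  fixes n :: nat
  obtains k where "n = 3 * k" | k where "n = Suc (3 * k)" | k where "n = Suc (Suc (3 * k))"
proof -
  have "n = 3 * (n div 3) + n mod 3" by simp
  moreover have "n mod 3 = 0 \<or> n mod 3 = 1 \<or> n mod 3 = 2" by linarith
  ultimately show ?thesis using that by (metis Suc_eq_plus1 add.right_neutral add_2_eq_Suc')
qed

text \<open>The explicit powers suffice: exponents 4k, 4k+1, 4k+3 against n = 3k, 3k+1,
  3k+2.\<close>

lemma fps_X_power_dvd_remainder: "fps_X ^ n dvd remainder (Suc n)"
  by (cases n rule: nat_mod_3_cases)
    (simp_all only: remainder_simps, auto intro!: dvd_mult2 le_imp_power_dvd simp del: power_Suc)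

lemma remainder_1: "remainder 1 = Abs_fps euler_number"
proof -
  have "rem0 0 = fps_tan 1 + 1 / fps_cos 1" by (simp add: rem0_def tansec_def)
  then show ?thesis
    using remainder_simps(2)[of 0] by (simp add: fps_laplace_def fps_eq_iff euler_number_def)
qed

lemma remainder_rec_1:
  "remainder (Suc (Suc (3 * k))) = (1 - (6 * of_nat k + 1) * fps_X) * remainder (Suc (3 * k)) +
     (if k = 0 then 1 else - (4 * of_nat k ^ 2) * fps_X ^ 2) * remainder (3 * k)"
proof (cases k)
  case 0
  \<comment> \<open>The Laplace rule applies to u but not to \<open>rem0 0 = 1 + u\<close>; the
    missing 1 is supplied by \<open>a 1 = 1\<close> times \<open>remainder 0 = - 1\<close>.\<close>
  have "rem1 0 = fps_deriv tansec - rem0 0"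
    by (simp add: rem0_def rem1_def tansec_deriv)
  then have "fps_X * fps_laplace (rem1 0) = fps_laplace tansec - fps_X * fps_laplace (rem0 0)"
    by (simp add: fps_laplace_diff right_diff_distrib fps_X_mult_laplace_deriv tansec_0)
  moreover have "fps_laplace (rem0 0) = 1 + fps_laplace tansec"
    by (simp add: rem0_def fps_laplace_add) (simp add: fps_laplace_def fps_eq_iff)
  ultimately show ?thesis
    using remainder_simps(1) remainder_simps(2,3)[of 0] 0 by (simp add: algebra_simps)
next
  case (Suc j)
  let ?K = "of_nat j :: rat fps"
  have "fps_laplace (rem1 (Suc j)) = fps_laplace (fps_deriv (rem0 (Suc j))) -
      (6 * ?K + 7) * fps_laplace (rem0 (Suc j)) - 4 * (?K + 1) ^ 2 * fps_laplace (rem2 j)"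
    using fps_laplace_of_nat[of "6 * j + 7" "rem0 (Suc j)", unfolded of_nat_push]
      fps_laplace_of_nat[of "4 * (j + 1) ^ 2" "rem2 j", unfolded of_nat_push]
    by (simp only: rem1_Suc fps_laplace_diff)
  moreover have "fps_X * fps_laplace (fps_deriv (rem0 (Suc j))) = fps_laplace (rem0 (Suc j))"
    by (rule fps_X_mult_laplace_deriv) (rule rem_nth_0)
  ultimately have *: "fps_X * fps_laplace (rem1 (Suc j)) = fps_laplace (rem0 (Suc j)) -
      (6 * ?K + 7) * fps_X * fps_laplace (rem0 (Suc j)) - 4 * (?K + 1) ^ 2 * fps_X * fps_laplace (rem2 j)"
    by algebra
  \<comment> \<open>Naming this power leaves only numeral exponents for
    \<open>algebra\<close>.\<close>
  define Y where "Y = (fps_X :: rat fps) ^ (4 * j)"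
  have S: "remainder (Suc (Suc (3 * k))) = Y * fps_X ^ 5 * fps_laplace (rem1 (Suc j))"
    "remainder (Suc (3 * k)) = Y * fps_X ^ 4 * fps_laplace (rem0 (Suc j))"
    "remainder (3 * k) = Y * fps_X ^ 3 * fps_laplace (rem2 j)"
    unfolding Suc remainder_simps(2,3) remainder_simps(4)[of j, folded three_times_Suc]
    by (simp_all add: Y_def flip: power_add)
  have K: "of_nat k = ?K + 1" and "k \<noteq> 0" using Suc by simp_all
  then show ?thesis
    unfolding S K using * \<open>k \<noteq> 0\<close> by (simp only: if_False) algebra
qed

text \<open>Here two derivatives of \<open>rem1 k\<close> enter, whence the quadratic coefficient
  and the jump of the exponent from 4k+1 to 4k+3.\<close>

lemma remainder_rec_2:
  "remainder (Suc (Suc (Suc (3 * k)))) =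
     (1 - 2 * (2 * of_nat k + 1) * fps_X - 4 * (2 * of_nat k + 1) ^ 2 * fps_X ^ 2) * remainder (Suc (Suc (3 * k)))
     - (4 * of_nat k + 1) ^ 2 * (2 * of_nat k + 1) * fps_X ^ 3 * remainder (Suc (3 * k))"
proof -
  let ?K = "of_nat k :: rat fps"
  have "fps_laplace (rem2 k) = fps_laplace (fps_deriv (fps_deriv (rem1 k))) -
      2 * (2 * ?K + 1) * fps_laplace (fps_deriv (rem1 k)) - 4 * (2 * ?K + 1) ^ 2 * fps_laplace (rem1 k)
      - (4 * ?K + 1) ^ 2 * (2 * ?K + 1) * fps_laplace (rem0 k)"
    using fps_laplace_of_nat[of "2 * (2 * k + 1)" "fps_deriv (rem1 k)", unfolded of_nat_push]
      fps_laplace_of_nat[of "4 * (2 * k + 1) ^ 2" "rem1 k", unfolded of_nat_push]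
      fps_laplace_of_nat[of "(4 * k + 1) ^ 2 * (2 * k + 1)" "rem0 k", unfolded of_nat_push]
    by (simp only: rem2 fps_laplace_diff)
  moreover have "fps_X * fps_laplace (fps_deriv (rem1 k)) = fps_laplace (rem1 k)"
    "fps_X * fps_laplace (fps_deriv (fps_deriv (rem1 k))) = fps_laplace (fps_deriv (rem1 k))"
    by (rule fps_X_mult_laplace_deriv, rule rem_nth_0)+
  ultimately have *: "fps_X ^ 2 * fps_laplace (rem2 k) = fps_laplace (rem1 k) -
      2 * (2 * ?K + 1) * fps_X * fps_laplace (rem1 k) - 4 * (2 * ?K + 1) ^ 2 * fps_X ^ 2 * fps_laplace (rem1 k)
      - (4 * ?K + 1) ^ 2 * (2 * ?K + 1) * fps_X ^ 2 * fps_laplace (rem0 k)"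
    by algebra
  define Y where "Y = (fps_X :: rat fps) ^ (4 * k)"
  show ?thesis
    unfolding remainder_simps power_add power_one_right Y_def[symmetric] using * by algebra
qed

lemma remainder_rec_3:
  "remainder (Suc (Suc (Suc (Suc (3 * k))))) =
     (1 - (6 * of_nat k + 5) * fps_X) * remainder (Suc (Suc (Suc (3 * k))))
     - (4 * of_nat k + 3) ^ 2 * (2 * of_nat k + 1) * fps_X ^ 3 * remainder (Suc (Suc (3 * k)))"
proof -
  let ?K = "of_nat k :: rat fps"
  have "fps_laplace (rem0 (Suc k)) = fps_laplace (fps_deriv (rem2 k)) -
      (6 * ?K + 5) * fps_laplace (rem2 k) - (4 * ?K + 3) ^ 2 * (2 * ?K + 1) * fps_laplace (rem1 k)"
    using fps_laplace_of_nat[of "6 * k + 5" "rem2 k", unfolded of_nat_push]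
      fps_laplace_of_nat[of "(4 * k + 3) ^ 2 * (2 * k + 1)" "rem1 k", unfolded of_nat_push]
    by (simp only: rem0_Suc fps_laplace_diff)
  moreover have "fps_X * fps_laplace (fps_deriv (rem2 k)) = fps_laplace (rem2 k)"
    by (rule fps_X_mult_laplace_deriv) (rule rem_nth_0)
  ultimately have *: "fps_X * fps_laplace (rem0 (Suc k)) = fps_laplace (rem2 k) -
      (6 * ?K + 5) * fps_X * fps_laplace (rem2 k)
      - (4 * ?K + 3) ^ 2 * (2 * ?K + 1) * fps_X * fps_laplace (rem1 k)"
    by algebra
  have "remainder (Suc (Suc (Suc (Suc (3 * k))))) = fps_X ^ (4 * k + 4) * fps_laplace (rem0 (Suc k))"
    using remainder_simps(2)[of "Suc k"] by (simp add: numeral_eq_Suc)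
  moreover define Y where "Y = (fps_X :: rat fps) ^ (4 * k)"
  ultimately show ?thesis
    unfolding remainder_simps power_add power_one_right Y_def[symmetric] using * by algebra
qed

section \<open>The expansion of the Euler number series\<close>

theorem theorem1p1:
  fixes a b :: "nat \<Rightarrow> rat poly"
  assumes a1: "a 1 = 1"
    and a_3k: "\<And>k. k \<ge> 1 \<Longrightarrow>
      a (3 * k) = monom (- ((4 * of_nat k - 1) ^ 2 * (2 * of_nat k - 1))) 3"
    and a_3k1: "\<And>k. k \<ge> 1 \<Longrightarrow> a (3 * k + 1) = monom (- (4 * of_nat k ^ 2)) 2"
    and a_3k2: "\<And>k. a (3 * k + 2) = monom (- ((4 * of_nat k + 1) ^ 2 * (2 * of_nat k + 1))) 3"
    and b0: "b 0 = 0"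
    and b_3k: "\<And>k. k \<ge> 1 \<Longrightarrow> b (3 * k) = [:1, - (6 * of_nat k - 1):]"
    and b_3k1: "\<And>k. b (3 * k + 1) = [:1, - (6 * of_nat k + 1):]"
    and b_3k2: "\<And>k. b (3 * k + 2) =
      [:1, - (2 * (2 * of_nat k + 1)), - (4 * (2 * of_nat k + 1) ^ 2):]"
  shows "has_cfrac_expansion (Abs_fps euler_number) a b \<and>
    b 1 = [:1, -1:] \<and>
    a 2 = - monom 1 3 \<and> b 2 = [:1, -2, -4:] \<and>
    a 3 = - monom 9 3 \<and> b 3 = [:1, -5:] \<and>
    a 4 = - monom 4 2 \<and> b 4 = [:1, -7:] \<and>
    a 5 = - monom 75 3 \<and> b 5 = [:1, -6, -36:]"
proof (intro conjI)
  \<comment> \<open>Replacing k by k + 1 removes the condition \<open>k \<ge> 1\<close>: 4(k+1) - 1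
    = 4k + 3 and 2(k+1) - 1 = 2k + 1.\<close>
  have a_3k': "a (Suc (Suc (Suc (3 * k)))) =
      monom (- ((4 * of_nat k + 3) ^ 2 * (2 * of_nat k + 1))) 3" for k
    using a_3k[of "Suc k", unfolded three_times_Suc] by (simp add: algebra_simps)
  have b_3k': "b (Suc (Suc (Suc (3 * k)))) = [:1, - (6 * of_nat k + 5):]" for k
    using b_3k[of "Suc k", unfolded three_times_Suc] by (simp add: algebra_simps)
  note a_simps = a_3k1[unfolded Suc_eq_plus1[symmetric]] a_3k2[unfolded add_2_eq_Suc'] a_3k'
  note b_simps = b_3k1[unfolded Suc_eq_plus1[symmetric]] b_3k2[unfolded add_2_eq_Suc'] b_3k'
  have b_0: "poly.coeff (b (Suc n)) 0 \<noteq> 0" for n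
    by (cases n rule: nat_mod_3_cases) (simp_all add: b_simps)
  \<comment> \<open>Starts at index 2, since \<open>a 1 = 1\<close>.\<close>
  have a_0: "poly.coeff (a (Suc (Suc n))) 0 = 0" for n
  proof (cases n rule: nat_mod_3_cases)
    \<comment> \<open>Now \<open>Suc (Suc n)\<close> is 3(k+1) + 1, the residue whose formula starts
      at 1.\<close>
    case (3 k)
    then show ?thesis using a_simps(1)[of "Suc k", unfolded three_times_Suc] by simp
  qed (simp_all add: a_simps)
  have rec: "remainder (Suc (Suc n)) = fps_of_poly (b (Suc n)) * remainder (Suc n) +
      fps_of_poly (a (Suc n)) * remainder n" for n
  proof (cases n rule: nat_mod_3_cases)
    case (1 k)
    have "fps_of_poly (b (Suc n)) = 1 - (6 * of_nat k + 1) * fps_X"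
      unfolding 1 b_simps fps_of_poly_pCons fps_of_poly_0 push_fps_const by algebra
    moreover have "fps_of_poly (a (Suc n)) = (if k = 0 then 1 else - (4 * of_nat k ^ 2) * fps_X ^ 2)"
    proof (cases "k = 0")
      case True
      then show ?thesis using a1 1 by simp
    next
      case False
      then have "fps_of_poly (a (Suc n)) = fps_const (- (4 * of_nat k ^ 2)) * fps_X ^ 2"
        unfolding 1 by (simp add: a_simps(1) fps_of_poly_monom)
      then show ?thesis unfolding push_fps_const using False by simp
    qed
    ultimately show ?thesis using remainder_rec_1[of k] 1 by simp
  next
    case (2 k)
    have "fps_of_poly (b (Suc n)) =
        1 - 2 * (2 * of_nat k + 1) * fps_X - 4 * (2 * of_nat k + 1) ^ 2 * fps_X ^ 2"
      unfolding 2 b_simps fps_of_poly_pCons fps_of_poly_0 push_fps_const by algebra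
    moreover have "fps_of_poly (a (Suc n)) = - ((4 * of_nat k + 1) ^ 2 * (2 * of_nat k + 1)) * fps_X ^ 3"
      unfolding 2 a_simps fps_of_poly_monom push_fps_const by (rule refl)
    ultimately show ?thesis using remainder_rec_2[of k] 2 by simp
  next
    case (3 k)
    have "fps_of_poly (b (Suc n)) = 1 - (6 * of_nat k + 5) * fps_X"
      unfolding 3 b_simps fps_of_poly_pCons fps_of_poly_0 push_fps_const by algebra
    moreover have "fps_of_poly (a (Suc n)) = - ((4 * of_nat k + 3) ^ 2 * (2 * of_nat k + 1)) * fps_X ^ 3"
      unfolding 3 a_simps fps_of_poly_monom push_fps_const by (rule refl)
    ultimately show ?thesis using remainder_rec_3[of k] 3 by simp
  qed
  show "has_cfrac_expansion (Abs_fps euler_number) a b"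
  proof (rule has_cfrac_expansionI[where S = remainder])
    show "poly.coeff (b j) 0 \<noteq> 0" if "j \<ge> 1" for j
      using b_0[of "j - 1"] that by simp
    show "poly.coeff (a j) 0 = 0" if "j \<ge> 2" for j
    proof -
      have "Suc (Suc (j - 2)) = j" using that by simp
      then show ?thesis using a_0[of "j - 2"] by simp
    qed
    show "remainder 1 = Abs_fps euler_number - fps_of_poly (b 0)"
      by (simp add: remainder_1 b0 del: One_nat_def)
  qed (rule rec fps_X_power_dvd_remainder remainder_simps(1))+
  show "b 1 = [:1, -1:]" "b 2 = [:1, -2, -4:]" "b 3 = [:1, -5:]" "b 4 = [:1, -7:]" "b 5 = [:1, -6, -36:]"
    using b_3k1[of 0] b_3k2[of 0] b_3k[of 1] b_3k1[of 1] b_3k2[of 1] by (simp_all add: numeral_eq_Suc)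
  show "a 2 = - monom 1 3" "a 3 = - monom 9 3" "a 4 = - monom 4 2" "a 5 = - monom 75 3"
    using a_3k2[of 0] a_3k[of 1] a_3k1[of 1] a_3k2[of 1] by (simp_all add: minus_monom numeral_2_eq_2)
qed

end
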